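(* Let $k\ge 2$, $n\ge 2$, and $2\le m\le|\mathbf{Neck}_k(n)|$. Let $\alpha_1,\alpha_2,\ldots,\alpha_m$ be the first $m$ strings of $\mathbf{Neck}_k(n)$ when it is listed in colexicographic order. Then $\text{UC}(\alpha_1,\ldots,\alpha_m)=pr(\alpha_1)pr(\alpha_2)\cdots pr(\alpha_m)$ is a universal cycle for $\mathbf{S}=\bigcup_{i=1}^m\mathbf{sub}_n(\alpha_i)$.
   Context: $\Sigma_k=\{0,1,\ldots,k-1\}$ with the natural order; $\Sigma_k^n$ is the set of strings of length $n$ over $\Sigma_k$. A necklace is a string that is lexicographically smallest among all its rotations; $\mathbf{Neck}_k(n)$ is the set of $k$-ary necklaces of length $n$. Colexicographic order on strings of equal length: $a_1\cdots a_n$ precedes $b_1\cdots b_n$ if $a_i<b_i$ at the largest $i$ with $a_i\ne b_i$. The periodic reduction $pr(a_1\cdots a_n)$ is $a_1\cdots a_p$ where $p$ is the smallest integer with $a_1\cdots a_n=(a_1\cdots a_p)^{n/p}$. For a string $\alpha$, $\mathbf{sub}_n(\alpha)$ is the set of all length-$n$ substrings of $\alpha$ viewed as a cyclic string (windows may wrap around). For a nonempty $\mathbf{S}\subseteq\Sigma_k^n$, a universal cycle for $\mathbf{S}$ is a string of length $|\mathbf{S}|$ which, viewed cyclically, contains every string of $\mathbf{S}$ as a length-$n$ substring exactly once. *)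

theory Defs
  imports Main "HOL-Library.List_Lexorder"
begin

text \<open>Letters are natural numbers; position \<open>i\<close> of a string is its \<open>i + 1\<close>-st letter.\<close>

definition strings :: "nat \<Rightarrow> nat \<Rightarrow> nat list set" where
  "strings k n = {w. length w = n \<and> set w \<subseteq> {..<k}}"

definition necklace :: "nat list \<Rightarrow> bool" where
  "necklace w \<longleftrightarrow> (\<forall>i. w \<le> rotate i w)"

definition Neck :: "nat \<Rightarrow> nat \<Rightarrow> nat list set" where
  "Neck k n = {w \<in> strings k n. necklace w}"

definition colex_less :: "nat list \<Rightarrow> nat list \<Rightarrow> bool" where
  "colex_less a b \<longleftrightarrow> length a = length b \<and>
     (\<exists>i<length a. a ! i < b ! i \<and> (\<forall>j. i < j \<and> j < length a \<longrightarrow> a ! j = b ! j))"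

definition pr :: "nat list \<Rightarrow> nat list" where
  "pr w = take (LEAST p. 0 < p \<and> p dvd length w \<and>
                  w = concat (replicate (length w div p) (take p w))) w"

definition cyclic_window :: "nat \<Rightarrow> nat list \<Rightarrow> nat \<Rightarrow> nat list" where
  "cyclic_window n w i = map (\<lambda>j. w ! ((i + j) mod length w)) [0..<n]"

definition sub :: "nat \<Rightarrow> nat list \<Rightarrow> nat list set" where
  "sub n w = cyclic_window n w ` {..<length w}"

text \<open>``Exactly once'' counts starting positions modulo the length of the cycle.\<close>

definition universal_cycle :: "nat \<Rightarrow> nat \<Rightarrow> nat list set \<Rightarrow> nat list \<Rightarrow> bool" where
  "universal_cycle k n S u \<longleftrightarrow>
     S \<noteq> {} \<and> S \<subseteq> strings k n \<and>
     set u \<subseteq> {..<k} \<and> length u = card S \<and>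
     (\<forall>s\<in>S. \<exists>!i. i < length u \<and> cyclic_window n u i = s)"

definition UC :: "nat list list \<Rightarrow> nat list" where
  "UC as = concat (map pr as)"

end

theory Submission
  imports Defs
begin

text \<open>
  Write a necklace other than \<open>0\<^sup>n\<close> as \<open>\<alpha> = 0\<^sup>j x \<beta>\<close> with \<open>x > 0\<close>. Lowering \<open>x\<close> by one gives
  another necklace, which precedes \<open>\<alpha>\<close> in colexicographic order and also ends in \<open>\<beta>\<close>; hence the
  immediate predecessor of \<open>\<alpha>\<close> ends in \<open>\<beta>\<close> too. By induction the cycle \<open>U\<close> built so far ends in
  that predecessor, so it ends in \<open>\<beta>\<close>, and it begins with \<open>0\<^sup>n\<close>. Since \<open>\<beta>\<close> and \<open>0\<^sup>j\<close>
  together have length \<open>n - 1\<close>, appending \<open>pr \<alpha>\<close> joins the cycles of \<open>U\<close> and \<open>pr \<alpha>\<close> at a common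
  factor of length \<open>n - 1\<close>, so no window is lost and all rotations of \<open>\<alpha>\<close> appear. As \<open>\<alpha>\<close> has
  exactly \<open>length (pr \<alpha>)\<close> distinct rotations, counting shows that each window occurs once.
\<close>

section \<open>Lexicographic order and necklaces\<close>

lemma lex_take_mono:
  fixes xs ys :: "'a::linorder list"
  assumes "xs \<le> ys"
  shows "take i xs \<le> take i ys"
  using assms
proof (induction i arbitrary: xs ys)
  case 0
  then show ?case by simp
next
  case (Suc i)
  then show ?case by (cases xs; cases ys) auto
qed

lemma lex_less_if_take_less:
  fixes xs ys :: "'a::linorder list"
  assumes "take i xs < take i ys"
  shows "xs < ys"
  using lex_take_mono[of ys xs i] assms by (meson leD leI)

lemma append_lex_less_cancel:
  fixes xs ys zs :: "'a::linorder list"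
  shows "xs @ ys < xs @ zs \<longleftrightarrow> ys < zs"
  by (induction xs) auto

lemma zeros_append_le:
  fixes b :: "nat list"
  shows "replicate i 0 @ b \<le> b @ replicate i 0"
proof (induction b)
  case Nil
  then show ?case by simp
next
  case (Cons y c)
  show ?case
  proof (cases "y = 0")
    case True
    have "replicate i 0 @ y # c = 0 # replicate i 0 @ c"
      using True by (metis append_Cons replicate_Suc replicate_app_Cons_same)
    then show ?thesis by (rule ssubst) (use Cons.IH True in simp)
  next
    case False
    then show ?thesis by (cases i) auto
  qed
qed

lemma necklace_iff:
  "necklace w \<longleftrightarrow> (\<forall>a b. w = a @ b \<longrightarrow> w \<le> b @ a)"
proof
  assume "necklace w"
  then show "\<forall>a b. w = a @ b \<longrightarrow> w \<le> b @ a"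
    unfolding necklace_def by (metis rotate_append)
next
  assume h: "\<forall>a b. w = a @ b \<longrightarrow> w \<le> b @ a"
  show "necklace w"
    unfolding necklace_def
  proof
    fix i
    show "w \<le> rotate i w"
      using h by (metis append_take_drop_id rotate_drop_take)
  qed
qed

lemma necklace_zeros: "necklace (replicate n 0)"
proof -
  have "rotate i (replicate n (0::nat)) = replicate n 0" for i
    by (intro nth_equalityI) (auto simp: nth_rotate)
  then show ?thesis by (simp add: necklace_def)
qed

lemma split_leading_zeros:
  fixes w :: "nat list"
  assumes "w \<noteq> replicate (length w) 0"
  obtains j x b where "w = replicate j 0 @ x # b" "0 < x"
  using assms
proof (induction w arbitrary: thesis)
  case Nil
  then show ?case by simp
next
  case (Cons y w)
  show ?case
  proof (cases "y = 0")
    case True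
    then obtain j x b where "w = replicate j 0 @ x # b" "0 < x"
      using Cons by auto
    then show ?thesis using Cons.prems(1)[of "Suc j" x b] True by simp
  next
    case False
    then show ?thesis using Cons.prems(1)[of 0 y w] by simp
  qed
qed

text \<open>The rotation starting at \<open>b\<close> is compared on its first \<open>j + 1\<close>
  letters; as \<open>b\<close> is nonempty, these do not reach \<open>x\<close>. The right side is
  thus unaffected when \<open>x\<close> is lowered.\<close>

lemma necklace_rotation_prefix:
  assumes "necklace (replicate j 0 @ x # e @ b)" "b \<noteq> []"
  shows "replicate j 0 @ [x] \<le> take (Suc j) (b @ replicate j 0)"
proof -
  have "(replicate j 0 @ x # e) @ b \<le> b @ replicate j 0 @ x # e"
    using assms(1) unfolding necklace_iff
    by (metis append.assoc append_Cons)
  from lex_take_mono[OF this, of "Suc j"] show ?thesis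
    using assms(2) by (cases b) auto
qed

text \<open>A last letter \<open>0\<close> would give a rotation with \<open>j + 1\<close> leading
  zeros.\<close>

lemma necklace_last_pos:
  assumes "necklace (replicate j 0 @ x # b)" "0 < x" "b \<noteq> []"
  shows "0 < last b"
proof (rule ccontr)
  assume "\<not> 0 < last b"
  then obtain c where c: "b = c @ [0]"
    using assms(3) by (metis append_butlast_last_id neq0_conv)
  then have "replicate j 0 @ [x] \<le> take (Suc j) ([0] @ replicate j 0)"
    using necklace_rotation_prefix[of j x c "[0]"] assms(1) by simp
  also have "\<dots> = replicate j 0 @ [0]"
    by (simp add: replicate_append_same)
  finally show False
    using append_lex_less_cancel[of "replicate j 0" "[0]" "[x]"] assms(2) by (simp add: leD)
qed

text \<open>Rotations by at most \<open>j\<close> only move zeros to the back. Any other nontrivial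
  one starts inside \<open>b\<close> and keeps its old lower bound, which the lowered string is now
  strictly below.\<close>

lemma necklace_decrement:
  assumes nk: "necklace (replicate j 0 @ x # b)" and x: "0 < x"
  shows "necklace (replicate j 0 @ (x - 1) # b)" (is "necklace ?w")
  unfolding necklace_iff
proof (intro allI impI)
  fix a c
  assume w: "?w = a @ c"
  show "?w \<le> c @ a"
  proof (cases "length a \<le> j")
    case True
    then have "a = replicate (length a) 0"
      using arg_cong[OF w, of "take (length a)"] by (simp add: min_def)
    then show ?thesis using w zeros_append_le by metis
  next
    case False
    then obtain e where e: "a = replicate j 0 @ (x - 1) # e" "b = e @ c"
      using w by (auto simp: append_eq_append_conv2 Cons_eq_append_conv dest: arg_cong[of _ _ length])
    show ?thesis
    proof (cases "c = []")
      case True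
      then show ?thesis using w by simp
    next
      case False
      have "take (Suc j) ?w < replicate j 0 @ [x]"
        using x by (simp add: append_lex_less_cancel)
      also have "\<dots> \<le> take (Suc j) (c @ replicate j 0)"
        using necklace_rotation_prefix[of j x e c] nk e False by simp
      also have "\<dots> = take (Suc j) (c @ a)"
        using False e(1) by (cases c) auto
      finally show ?thesis
        using lex_less_if_take_less less_imp_le by blast
    qed
  qed
qed

section \<open>Colexicographic order\<close>

lemma colex_less_irrefl: "\<not> colex_less a a"
  by (auto simp: colex_less_def)

lemma colex_less_trans:
  assumes "colex_less a b" "colex_less b c"
  shows "colex_less a c"
proof -
  obtain i where i: "i < length a" "a ! i < b ! i"
    "\<And>l. i < l \<Longrightarrow> l < length a \<Longrightarrow> a ! l = b ! l"
    using assms(1) by (auto simp: colex_less_def)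
  obtain i' where i': "i' < length a" "b ! i' < c ! i'"
    "\<And>l. i' < l \<Longrightarrow> l < length a \<Longrightarrow> b ! l = c ! l"
    using assms by (auto simp: colex_less_def)
  have "a ! max i i' < c ! max i i'"
    using i i' by (cases i i' rule: linorder_cases) (auto simp: max_def)
  then show ?thesis
    using assms i i' unfolding colex_less_def
    by (intro conjI exI[of _ "max i i'"]) auto
qed

lemma not_colex_less_zeros: "\<not> colex_less a (replicate n 0)"
  by (auto simp: colex_less_def)

text \<open>If \<open>b\<close> did not end in \<open>s\<close>, its last differences from
  \<open>a @ s\<close> and from \<open>c @ s\<close> would be at the same place, with opposite
  inequalities against the same letter.\<close>

lemma colex_sandwich:
  assumes "colex_less (a @ s) b" "colex_less b (c @ s)" "length a = length c"
  obtains d where "b = d @ s"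
proof -
  let ?n = "length (a @ s)"
  have len: "length b = ?n" using assms(1) by (simp add: colex_less_def)
  obtain i where i: "i < ?n" "(a @ s) ! i < b ! i"
    "\<And>l. i < l \<Longrightarrow> l < ?n \<Longrightarrow> (a @ s) ! l = b ! l"
    using assms(1) by (auto simp: colex_less_def)
  obtain i' where i': "i' < ?n" "b ! i' < (c @ s) ! i'"
    "\<And>l. i' < l \<Longrightarrow> l < ?n \<Longrightarrow> b ! l = (c @ s) ! l"
    using assms(2) len by (auto simp: colex_less_def)
  have same: "(a @ s) ! l = (c @ s) ! l" if "length a \<le> l" for l
    using that assms(3) by (simp add: nth_append)
  have "i < length a"
  proof (rule ccontr)
    assume "\<not> i < length a"
    then show False
      using i i' same[of i] same[of i'] by (cases i i' rule: linorder_cases) auto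
  qed
  then have "drop (length a) b = s"
    using i(3)[symmetric] len by (intro nth_equalityI) (auto simp: nth_append)
  then show thesis using that by (metis append_take_drop_id)
qed

section \<open>Roots and periodic reduction\<close>

text \<open>A root inside the block of zeros would make the whole power zero, so the first copy of
  \<open>g\<close> already contains \<open>x\<close>.\<close>

lemma concat_replicate_leading_zeros:
  fixes x :: nat
  assumes "concat (replicate r g) = replicate j 0 @ x # b" "0 < x"
  obtains h t where "r = Suc t" "g = replicate j 0 @ x # h" "b = h @ concat (replicate t g)"
proof -
  obtain t where t: "r = Suc t" using assms(1) by (cases r) auto
  have eq: "g @ concat (replicate t g) = replicate j 0 @ x # b"
    using assms(1) t by simp
  have "j < length g"
  proof (rule ccontr)
    assume "\<not> j < length g"
    then have "g = replicate (length g) 0"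
      using arg_cong[OF eq, of "take (length g)"] by (simp add: min_def)
    then have "set g \<subseteq> {0}" by (metis set_replicate_conv_if empty_subsetI order_refl)
    moreover have "x \<in> set (concat (replicate r g))" using assms(1) by simp
    ultimately show False using assms(2) by auto
  qed
  then obtain h where "g = replicate j 0 @ x # h" "b = h @ concat (replicate t g)"
    using eq by (auto simp: append_eq_append_conv2 Cons_eq_append_conv append_eq_Cons_conv
        dest: arg_cong[of _ _ length])
  then show thesis using that t by blast
qed

text \<open>Turns the \<open>LEAST\<close> in \<open>pr\<close> into minimality among all roots: if
  a power of \<open>z\<close> is \<open>w\<close>, then \<open>length z\<close> meets the minimised
  condition.\<close>

lemma pr_root:
  assumes "w \<noteq> []"
  obtains r where "w = concat (replicate r (pr w))" "pr w \<noteq> []"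
    "\<And>z t. w = concat (replicate t z) \<Longrightarrow> length (pr w) \<le> length z"
proof -
  let ?P = "\<lambda>p. 0 < p \<and> p dvd length w \<and> w = concat (replicate (length w div p) (take p w))"
  have "?P (length w)" using assms by simp
  then have L: "?P (LEAST p. ?P p)" by (rule LeastI)
  then have len: "length (pr w) = (LEAST p. ?P p)"
    unfolding pr_def using assms by (simp add: dvd_imp_le)
  have "length (pr w) \<le> length z" if z: "w = concat (replicate t z)" for z t
  proof -
    have t: "0 < t" "z \<noteq> []" using z assms by (cases t; auto)+
    have lw: "length w = t * length z"
      using z by (simp add: length_concat sum_list_replicate)
    have "take (length z) w = z" using z t by (cases t) auto
    then have "?P (length z)" using t lw z by simp
    then show ?thesis unfolding len by (rule Least_le)
  qed
  moreover have "w = concat (replicate (length w div (LEAST p. ?P p)) (pr w))"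
    using L unfolding pr_def by blast
  moreover have "pr w \<noteq> []" using len L by auto
  ultimately show thesis using that by blast
qed

lemma pr_zeros:
  assumes "0 < n"
  shows "pr (replicate n 0) = [0]"
proof -
  define w where "w = replicate n (0::nat)"
  have w: "w \<noteq> []" using assms by (simp add: w_def)
  have "w = concat (replicate n [0])"
    unfolding w_def by (induction n) auto
  then have "pr w \<noteq> []" "length (pr w) \<le> length [0::nat]"
    using pr_root[OF w] by metis+
  moreover have "set (pr w) \<subseteq> {0}"
    unfolding pr_def using set_take_subset[of _ w] by (auto simp: w_def dest: in_set_takeD)
  ultimately show ?thesis
    unfolding w_def by (cases "pr (replicate n 0)") auto
qed

section \<open>Rotations, cyclic windows and factors\<close>

lemma cyclic_window_eq_rotate:
  assumes "length w = n"
  shows "cyclic_window n w i = rotate i w"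
  using assms by (intro nth_equalityI) (auto simp: cyclic_window_def nth_rotate)

lemma sub_eq_rotations: "sub (length w) w = (\<lambda>i. rotate i w) ` {..<length w}"
  by (simp add: sub_def cyclic_window_eq_rotate)

lemma rotate_cancel: "rotate i v = rotate i w \<Longrightarrow> v = w"
  unfolding rotate_def using inj_fn[OF inj_rotate1] by (rule injD)

lemma rotate_root:
  assumes "w = concat (replicate r g)"
  shows "rotate (i * length g) w = w"
proof -
  have "rotate (length g) w = w"
  proof (cases r)
    case (Suc t)
    have "concat (replicate t g) @ g = g @ concat (replicate t g)"
      by (induction t) auto
    then show ?thesis using assms Suc by (simp add: rotate_append)
  qed (use assms in simp)
  then show ?thesis
    by (induction i) (simp_all add: rotate_rotate[symmetric])
qed

lemma sub_eq_rotations_pr: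
  assumes "w \<noteq> []"
  shows "sub (length w) w = (\<lambda>i. rotate i w) ` {..<length (pr w)}"
proof -
  obtain r where r: "w = concat (replicate r (pr w))" "pr w \<noteq> []"
    using pr_root[OF assms] by metis
  have "rotate i w = rotate (i mod length (pr w)) w" for i
    using rotate_root[OF r(1), of "i div length (pr w)"]
    by (metis mod_div_mult_eq rotate_rotate)
  moreover have "length (pr w) \<le> length w"
    by (simp add: pr_def)
  ultimately show ?thesis
    unfolding sub_eq_rotations using r(2)
    by (force simp: image_iff intro: mod_less_divisor)
qed

text \<open>Two rotations of \<open>w\<close> by different amounts below \<open>length (pr w)\<close> that agree yield a
  commuting factorisation of \<open>w\<close>, hence a root of \<open>w\<close> shorter than \<open>pr w\<close>.\<close>

lemma inj_on_rotate_pr: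
  assumes "w \<noteq> []"
  shows "inj_on (\<lambda>i. rotate i w) {..<length (pr w)}"
proof (rule linorder_inj_onI')
  fix i i'
  assume i: "i \<in> {..<length (pr w)}" "i' \<in> {..<length (pr w)}" "i < i'"
  show "rotate i w \<noteq> rotate i' w"
  proof
    assume eq: "rotate i w = rotate i' w"
    define d where "d = i' - i"
    have plw: "length (pr w) \<le> length w" by (simp add: pr_def)
    have d: "0 < d" "d < length (pr w)" using i by (auto simp: d_def)
    have "rotate i (rotate d w) = rotate i w"
      using eq i by (simp add: rotate_rotate d_def)
    then have "rotate d w = w" by (rule rotate_cancel)
    then have "drop d w @ take d w = take d w @ drop d w"
      using d plw by (simp add: rotate_drop_take)
    then obtain a b z where z: "concat (replicate a z) = take d w" "concat (replicate b z) = drop d w"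
      using comm_append_are_replicate[of "take d w" "drop d w"] by metis
    have "w = concat (replicate (a + b) z)"
      using z by (metis append_take_drop_id concat_append replicate_add)
    then have "length (pr w) \<le> length z" using pr_root[OF assms] by metis
    moreover have "length (take d w) = a * length z"
      unfolding z(1)[symmetric] by (simp add: length_concat sum_list_replicate)
    then have "d = a * length z" using d plw by simp
    ultimately show False using d by (cases a) auto
  qed
qed

lemma card_sub:
  assumes "w \<noteq> []"
  shows "card (sub (length w) w) = length (pr w)"
  using inj_on_rotate_pr[OF assms] assms by (simp add: sub_eq_rotations_pr card_image)

text \<open>A shared rotation makes each necklace a rotation of the other, hence each at most the
  other.\<close>

lemma sub_necklaces_disjoint:
  assumes "necklace v" "necklace w" "length v = n" "length w = n" "v \<noteq> w"
  shows "sub n v \<inter> sub n w = {}"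
proof (rule ccontr)
  assume "sub n v \<inter> sub n w \<noteq> {}"
  then obtain i l where eq: "rotate i v = rotate l w" "i < n" "l < n"
    using assms(3,4) sub_eq_rotations[of v] sub_eq_rotations[of w] by auto
  \<comment> \<open>Rotating on by \<open>n - i\<close> completes a full turn, so \<open>c\<close>
    is \<open>n - i + l\<close>.\<close>
  have "\<exists>c. v = rotate c w" if "rotate i v = rotate l w" "i < n" "length v = n" for i l v w
    using that by (metis (no_types) le_add_diff_inverse2 less_imp_le rotate_id mod_self rotate_rotate)
  from this[OF eq(1,2)] this[OF eq(1)[symmetric] eq(3)] assms show False
    unfolding necklace_def by (metis order_antisym)
qed

text \<open>The padding makes these the cyclic windows of a string that begins with \<open>0\<close> repeated
  \<open>n - 1\<close> times, without any wrapping around.\<close>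

definition factors :: "nat \<Rightarrow> nat list \<Rightarrow> nat list set" where
  "factors n w = {s. length s = n \<and> (\<exists>p q. w @ replicate (n - 1) 0 = p @ s @ q)}"

lemma factors_subset_windows:
  assumes "take (n - 1) w = replicate (n - 1) 0" "0 < n"
  shows "factors n w \<subseteq> cyclic_window n w ` {..<length w}"
proof
  fix s
  assume "s \<in> factors n w"
  then obtain p q where s: "length s = n" "w @ replicate (n - 1) 0 = p @ s @ q"
    by (auto simp: factors_def)
  have lw: "n - 1 \<le> length w" using arg_cong[OF assms(1), of length] by simp
  \<comment> \<open>The padding is one letter shorter than \<open>s\<close>, so \<open>s\<close>
    starts inside \<open>w\<close>.\<close>
  have lp: "length p < length w"
    using arg_cong[OF s(2), of length] s(1) assms(2) by simp
  have "cyclic_window n w (length p) = s"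
  proof (rule nth_equalityI)
    show "length (cyclic_window n w (length p)) = length s"
      using s(1) by (simp add: cyclic_window_def)
    fix l
    assume "l < length (cyclic_window n w (length p))"
    then have l: "l < n" by (simp add: cyclic_window_def)
    let ?i = "length p + l"
    have "s ! l = (w @ replicate (n - 1) 0) ! ?i"
      using s l by (simp add: nth_append)
    also have "\<dots> = w ! (?i mod length w)"
    proof (cases "?i < length w")
      case True
      then show ?thesis by (simp add: nth_append)
    next
      case False
      \<comment> \<open>Past the end of \<open>w\<close>, the padding and the wrapped index both
        read a zero.\<close>
      have b: "?i - length w < n - 1" using False l lp by linarith
      have "w ! (?i - length w) = 0"
        using b assms(1) by (metis nth_replicate nth_take)
      moreover have "?i mod length w = ?i - length w"
        using False b lw by (simp add: mod_if)
      ultimately show ?thesis using False b by (simp add: nth_append)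
    qed
    finally show "cyclic_window n w (length p) ! l = s ! l"
      using l by (simp add: cyclic_window_def)
  qed
  then show "s \<in> cyclic_window n w ` {..<length w}" using lp by auto
qed

section \<open>Appending the root of a new word\<close>

text \<open>\<open>u\<close> is the cycle built so far and the power of \<open>g\<close> is the next
  necklace; \<open>suffix_b\<close> is what the colexicographic order provides.\<close>

locale append_root =
  fixes j x r n :: nat and b g u :: "nat list"
  assumes root: "concat (replicate r g) = replicate j 0 @ x # b"
    and x_pos: "0 < x"
    and len: "length (replicate j 0 @ x # b) = n"
    and suffix_b: "\<exists>v. u = v @ b"
begin

text \<open>With \<open>g = replicate j 0 @ x # h\<close>, \<open>b\<close> is \<open>h\<close>
  followed by \<open>r - 1\<close> copies of \<open>g\<close>, so one more \<open>g\<close> after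
  \<open>u\<close> completes \<open>r\<close> copies.\<close>

lemma append_root_suffix: "\<exists>v. u @ g = v @ concat (replicate r g)"
proof -
  obtain h t where "r = Suc t" "g = replicate j 0 @ x # h" "b = h @ concat (replicate t g)"
    using concat_replicate_leading_zeros[OF root x_pos] by metis
  moreover have "concat (replicate t g) @ g = g @ concat (replicate t g)" for t
    by (induction t) auto
  ultimately show ?thesis using suffix_b by auto
qed

text \<open>Since \<open>g\<close> begins with \<open>j\<close> zeros, \<open>u\<close> followed by
  \<open>j\<close> zeros remains a prefix; since \<open>u @ g\<close> again ends in
  \<open>b\<close>, factors starting in the final \<open>b\<close> or later reappear at the
  end.\<close>

lemma factors_append_root: "factors n u \<subseteq> factors n (u @ g)"
proof
  fix s
  assume "s \<in> factors n u"
  then obtain p q where s: "length s = n" "u @ replicate (n - 1) 0 = p @ s @ q"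
    by (auto simp: factors_def)
  obtain v where v: "u = v @ b" using suffix_b by blast
  obtain h where g: "g = replicate j 0 @ x # h"
    using concat_replicate_leading_zeros[OF root x_pos] by metis
  have nj: "n - 1 = j + length b" using len by simp
  show "s \<in> factors n (u @ g)"
  \<comment> \<open>As \<open>n - 1 = j + length b\<close>, a factor running past the
    \<open>j\<close> zeros after \<open>u\<close> starts no earlier than \<open>b\<close>.\<close>
  proof (cases "length p + n \<le> length u + j")
    case True
    have "take (length u + j) (u @ replicate (n - 1) 0) = u @ replicate j 0"
      using nj by simp
    then have "u @ replicate j 0 = take (length u + j) (p @ s @ q)"
      unfolding s(2) by (rule sym)
    then have "u @ replicate j 0 = p @ s @ take (length u + j - length p - n) q"
      using s(1) True by simp
    then have "(u @ g) @ replicate (n - 1) 0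
        = p @ s @ take (length u + j - length p - n) q @ x # h @ replicate (n - 1) 0"
      using g by (metis append.assoc append_Cons)
    then show ?thesis using s(1) by (auto simp: factors_def)
  next
    case False
    then have "length v \<le> length p" using v len by simp
    then have "b @ replicate (n - 1) 0 = drop (length v) p @ s @ q"
      using arg_cong[OF s(2), of "drop (length v)"] v by simp
    moreover obtain v' where "u @ g = v' @ b"
      using append_root_suffix root by (metis append.assoc append_Cons append_Nil)
    ultimately have "(u @ g) @ replicate (n - 1) 0 = (v' @ drop (length v) p) @ s @ q"
      by simp
    then show ?thesis using s(1) unfolding factors_def by blast
  qed
qed

lemma sub_subset_factors:
  assumes "pr (concat (replicate r g)) = g"
  shows "sub n (concat (replicate r g)) \<subseteq> factors n (u @ g)"
proof
  let ?w = "concat (replicate r g)"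
  fix s
  assume "s \<in> sub n ?w"
  moreover have w: "?w \<noteq> []" "length ?w = n" using root len by auto
  ultimately obtain i where i: "i < length g" "s = rotate i ?w"
    using sub_eq_rotations_pr[OF w(1)] assms by auto
  obtain v where v: "u = v @ b" using suffix_b by blast
  obtain h t where h: "r = Suc t" "g = replicate j 0 @ x # h" "b = h @ concat (replicate t g)"
    using concat_replicate_leading_zeros[OF root x_pos] by metis
  have comm: "concat (replicate t g) @ g = g @ concat (replicate t g)" for t
    by (induction t) auto
  have s: "s = drop i g @ concat (replicate t g) @ take i g"
    using i h(1) w by (simp add: rotate_drop_take comm_append_is_replicate)
  have ug: "u @ g = v @ h @ g @ concat (replicate t g)"
    using v h(3) comm by simp
  have "\<exists>p q. (u @ g) @ replicate (n - 1) 0 = p @ s @ q"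
  \<comment> \<open>For \<open>i <= j\<close> the rotation starts in the first of the final
    \<open>r\<close> copies of \<open>g\<close> and takes its last \<open>i\<close> zeros from the
    padding; otherwise it starts in the \<open>h\<close> before these copies.\<close>
  proof (cases "i \<le> j")
    case True
    have ti: "take i g = replicate i 0" using True h(2) by simp
    have "replicate (n - 1) 0 = replicate i 0 @ replicate (n - 1 - i) (0::nat)"
      using True len by (simp add: replicate_add[symmetric])
    then have "(u @ g) @ replicate (n - 1) 0
        = (v @ h @ take i g) @ s @ replicate (n - 1 - i) 0"
      unfolding ug s ti by (metis append.assoc append_take_drop_id ti)
    then show ?thesis by blast
  next
    case False
    have "drop i g = drop (i - Suc j) h" using False h(2) by (simp add: drop_Cons')
    then have "h = take (i - Suc j) h @ drop i g" by simp
    then have "u @ g = (v @ take (i - Suc j) h) @ s @ drop i g"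
      using comm[of t] unfolding ug s by (metis append.assoc append_take_drop_id)
    then show ?thesis by (metis append.assoc)
  qed
  moreover have "length s = n" using i w by simp
  ultimately show "s \<in> factors n (u @ g)" by (simp add: factors_def)
qed

end

section \<open>The necklaces in colexicographic order\<close>

locale colex_necklaces =
  fixes k n :: nat and necks :: "nat list list"
  assumes k: "0 < k" and n: "2 \<le> n"
    and set_necks: "set necks = Neck k n" and sorted: "sorted_wrt colex_less necks"
begin

lemma nth_necks:
  assumes "i < length necks"
  shows "necklace (necks ! i)" "length (necks ! i) = n" "set (necks ! i) \<subseteq> {..<k}"
  using nth_mem[OF assms] unfolding set_necks Neck_def strings_def by auto

lemma nth_necks_colex: "i < i' \<Longrightarrow> i' < length necks \<Longrightarrow> colex_less (necks ! i) (necks ! i')"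
  using sorted by (simp add: sorted_wrt_iff_nth_less)

lemma distinct_necks: "distinct necks"
  unfolding distinct_conv_nth
  using nth_necks_colex colex_less_irrefl by (metis linorder_neqE_nat)

lemma first_necklace: "0 < length necks" "necks ! 0 = replicate n 0"
proof -
  have "replicate n 0 \<in> set necks"
    unfolding set_necks Neck_def strings_def using necklace_zeros k by auto
  then obtain i where i: "i < length necks" "necks ! i = replicate n 0"
    by (auto simp: in_set_conv_nth)
  then show "0 < length necks" by auto
  show "necks ! 0 = replicate n 0"
    using i nth_necks_colex[of 0 i] not_colex_less_zeros by (cases "i = 0") auto
qed

lemma nth_necks_leading_zeros:
  assumes "0 < i" "i < length necks"
  obtains j x b where "necks ! i = replicate j 0 @ x # b" "0 < x"
  using split_leading_zeros[of "necks ! i"] nth_necks_colex[OF assms] nth_necks(2)[OF assms(2)]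
    not_colex_less_zeros by metis

lemma decrement_in_necks:
  assumes "i < length necks" "necks ! i = replicate j 0 @ x # b" "0 < x"
  obtains i' where "i' < i" "necks ! i' = replicate j 0 @ (x - 1) # b"
proof -
  let ?d = "replicate j 0 @ (x - 1) # b"
  have "?d \<in> set necks"
    unfolding set_necks Neck_def strings_def
    using necklace_decrement[of j x b] nth_necks[OF assms(1)] assms(2,3) by auto
  then obtain i' where i': "i' < length necks" "necks ! i' = ?d"
    by (auto simp: in_set_conv_nth)
  have "colex_less ?d (necks ! i)"
    unfolding colex_less_def using assms(2,3)
    by (intro conjI exI[of _ j]) (auto simp: nth_append nth_Cons')
  then have "i' < i"
    using i' assms(1) nth_necks_colex[of i i'] colex_less_trans colex_less_irrefl
    by (metis linorder_neqE_nat)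
  then show thesis using that i'(2) by blast
qed

text \<open>The lowered necklace is the predecessor or comes before it; in the second case the
  predecessor lies between two strings ending in \<open>b\<close>.\<close>

lemma previous_necklace_suffix:
  assumes "Suc i < length necks" "necks ! Suc i = replicate j 0 @ x # b" "0 < x"
  shows "\<exists>d. necks ! i = d @ b"
proof -
  obtain i' where i': "i' < Suc i" "necks ! i' = replicate j 0 @ (x - 1) # b"
    using decrement_in_necks[OF assms] by blast
  show ?thesis
  proof (cases "i' = i")
    case True
    then show ?thesis using i'(2) by (intro exI[of _ "replicate j 0 @ [x - 1]"]) simp
  next
    case False
    then have "colex_less ((replicate j 0 @ [x - 1]) @ b) (necks ! i)"
      using nth_necks_colex[of i' i] i' assms(1) by simp
    moreover have "colex_less (necks ! i) ((replicate j 0 @ [x]) @ b)"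
      using nth_necks_colex[of i "Suc i"] assms(1,2) by simp
    ultimately show ?thesis using colex_sandwich by (metis length_append_singleton length_replicate)
  qed
qed

text \<open>Serves the first append, where the cycle is only \<open>[0]\<close>. Lowering
  \<open>x\<close> must give the zero string, so \<open>b\<close> is all zeros, and a nonempty
  \<open>b\<close> would contradict \<open>necklace_last_pos\<close>.\<close>

lemma second_necklace:
  assumes "1 < length necks" "necks ! 1 = replicate j 0 @ x # b" "0 < x"
  shows "b = []"
proof (rule ccontr)
  assume b: "b \<noteq> []"
  have "replicate j 0 @ (x - 1) # b = replicate n 0"
    using decrement_in_necks[OF assms] first_necklace(2) by (metis less_one)
  then have "set b \<subseteq> {0}"
    by (metis set_replicate_conv_if empty_subsetI order_refl set_append set_subset_Cons
        le_sup_iff order_trans)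
  then have "last b = 0" using b last_in_set by blast
  then show False
    using necklace_last_pos[of j x b] nth_necks(1)[OF assms(1)] assms(2,3) b by simp
qed

text \<open>The suffix claim needs \<open>0 < i\<close> because the first cycle is
  \<open>[0]\<close>, too short to end in \<open>replicate n 0\<close>.\<close>

lemma UC_invariant:
  assumes "i < length necks"
  shows "(\<Union>w\<in>set (take (Suc i) necks). sub n w) \<subseteq> factors n (UC (take (Suc i) necks)) \<and>
    (0 < i \<longrightarrow> (\<exists>v. UC (take (Suc i) necks) = v @ necks ! i))"
  using assms
proof (induction i)
  case 0
  let ?z = "replicate n (0::nat)"
  have t: "take (Suc 0) necks = [?z]"
    using first_necklace by (simp add: take_Suc_conv_app_nth)
  \<comment> \<open>One zero and the \<open>n - 1\<close> zeros of padding form the only window of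
    \<open>?z\<close>.\<close>
  have "pr ?z = [0]" using pr_zeros n by simp
  then have "?z \<in> factors n (UC [?z])"
    using n by (auto simp: factors_def UC_def replicate_Suc[symmetric] intro!: exI[of _ "[]"])
  moreover have "sub n ?z \<subseteq> {?z}"
    by (auto simp: sub_def cyclic_window_def map_replicate_const)
  ultimately show ?case unfolding t by auto
next
  case (Suc i)
  let ?u = "UC (take (Suc i) necks)"
  let ?w = "necks ! Suc i"
  have i: "Suc i < length necks" using Suc.prems by simp
  obtain j x b where w: "?w = replicate j 0 @ x # b" "0 < x"
    using nth_necks_leading_zeros[of "Suc i"] i by blast
  then have "?w \<noteq> []" by simp
  then obtain r where r: "?w = concat (replicate r (pr ?w))"
    using pr_root by metis
  have t: "take (Suc (Suc i)) necks = take (Suc i) necks @ [?w]"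
    using i by (rule take_Suc_conv_app_nth)
  have U: "UC (take (Suc i) necks @ [?w]) = ?u @ pr ?w"
    by (simp add: UC_def)
  \<comment> \<open>For \<open>i = 0\<close> the suffix is empty; later \<open>?u\<close> ends in
    the previous necklace, which ends in \<open>b\<close>.\<close>
  have "\<exists>v. ?u = v @ b"
  proof (cases "i = 0")
    case True
    then show ?thesis using second_necklace[of j x b] i w by simp
  next
    case False
    then show ?thesis
      using Suc.IH previous_necklace_suffix[OF i w] i by (metis Suc_lessD append.assoc neq0_conv)
  qed
  then interpret append_root j x r n b "pr ?w" ?u
    using r w nth_necks(2)[OF i] by unfold_locales simp_all
  have "(\<Union>w\<in>set (take (Suc i) necks). sub n w) \<subseteq> factors n (?u @ pr ?w)"
    using Suc.IH factors_append_root i by auto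
  then show ?case
    using sub_subset_factors append_root_suffix unfolding t U r[symmetric] by simp
qed

text \<open>The second necklace is \<open>n - 1\<close> zeros and a positive letter, and its root
  begins with all these zeros. Hence the padding in \<open>factors\<close> agrees with wrapping
  around.\<close>

lemma UC_prefix:
  assumes "2 \<le> m" "m \<le> length necks"
  shows "take (n - 1) (UC (take m necks)) = replicate (n - 1) 0"
proof -
  have l: "1 < length necks" using assms by simp
  obtain j x b where w: "necks ! 1 = replicate j 0 @ x # b" "0 < x"
    using nth_necks_leading_zeros[of 1] l by auto
  then have b: "b = []" using second_necklace[OF l] by blast
  then have j: "j = n - 1" using nth_necks(2)[OF l] w by simp
  obtain r where "necks ! 1 = concat (replicate r (pr (necks ! 1)))"
    using pr_root[of "necks ! 1"] w(1) by (metis Nil_is_append_conv list.distinct(1))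
  then obtain h where h: "pr (necks ! 1) = replicate (n - 1) 0 @ x # h"
    using concat_replicate_leading_zeros w j by metis
  have q: "pr (necks ! 0) = [0]" using first_necklace(2) pr_zeros n by simp
  obtain ws where "necks = necks ! 0 # necks ! 1 # ws"
    using l by (cases necks; cases "tl necks") auto
  then have "take m necks = necks ! 0 # necks ! 1 # take (m - 2) ws"
    using assms(1) by (metis One_nat_def Suc_1 add_2_eq_Suc le_add_diff_inverse take_Suc_Cons)
  then have "UC (take m necks) = 0 # replicate (n - 1) 0 @ x # h @ UC (take (m - 2) ws)"
    using q h by (simp add: UC_def)
  then show ?thesis
    by (cases "n - 1") (simp_all add: replicate_append_same[symmetric])
qed

text \<open>Each necklace contributes \<open>length (pr w)\<close> letters and as many distinct
  rotations, and different necklaces share none.\<close>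

lemma length_UC: "length (UC (take m necks)) = card (\<Union>w\<in>set (take m necks). sub n w)"
proof -
  let ?A = "set (take m necks)"
  have A: "w \<in> ?A \<Longrightarrow> necklace w \<and> length w = n" for w
    using set_take_subset[of m necks] set_necks by (auto simp: Neck_def strings_def)
  have "length (UC (take m necks)) = (\<Sum>w\<in>?A. length (pr w))"
    using distinct_necks by (simp add: UC_def length_concat comp_def sum_list_distinct_conv_sum_set)
  also have "\<dots> = (\<Sum>w\<in>?A. card (sub n w))"
  proof (rule sum.cong)
    fix w assume "w \<in> ?A"
    with A[of w] n show "length (pr w) = card (sub n w)" using card_sub[of w] by force
  qed simp
  also have "\<dots> = card (\<Union>w\<in>?A. sub n w)"
    using A sub_necklaces_disjoint by (intro card_UN_disjoint[symmetric]) (auto simp: sub_def)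
  finally show ?thesis .
qed

end

section \<open>Counting the windows\<close>

theorem theorem3:
  fixes k n m :: nat and necks :: "nat list list"
  assumes "2 \<le> k" and "2 \<le> n" and "2 \<le> m" and "m \<le> card (Neck k n)"
    and "set necks = Neck k n" and "sorted_wrt colex_less necks"
  shows "universal_cycle k n (\<Union>\<alpha>\<in>set (take m necks). sub n \<alpha>) (UC (take m necks))"
proof -
  interpret colex_necklaces k n necks
    using assms by unfold_locales simp_all
  let ?S = "\<Union>\<alpha>\<in>set (take m necks). sub n \<alpha>"
  let ?U = "UC (take m necks)"
  have m: "m \<le> length necks" using assms(4,5) card_length[of necks] by simp
  have A: "w \<in> set (take m necks) \<Longrightarrow> length w = n \<and> set w \<subseteq> {..<k}" for w
    using set_take_subset[of m necks] set_necks by (auto simp: Neck_def strings_def)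
  have "?S \<subseteq> factors n ?U"
    using UC_invariant[of "m - 1"] m assms(3) by simp
  also have "\<dots> \<subseteq> cyclic_window n ?U ` {..<length ?U}"
    using factors_subset_windows[of n ?U] UC_prefix[OF assms(3) m] assms(2) by simp
  finally have sub: "?S \<subseteq> cyclic_window n ?U ` {..<length ?U}" .
  \<comment> \<open>\<open>?U\<close> has at most \<open>length ?U\<close> windows, and this length
    is the size of \<open>?S\<close>; so the inclusion is an equality and no window repeats.\<close>
  have card: "card (cyclic_window n ?U ` {..<length ?U}) \<le> card ?S"
    using card_image_le[of "{..<length ?U}" "cyclic_window n ?U"] length_UC[of m] by simp
  have eq: "cyclic_window n ?U ` {..<length ?U} = ?S"
    using card_seteq[OF _ sub card] by simp
  then have "inj_on (cyclic_window n ?U) {..<length ?U}"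
    using length_UC[of m] by (intro eq_card_imp_inj_on) simp_all
  then have "\<forall>s\<in>?S. \<exists>!i. i < length ?U \<and> cyclic_window n ?U i = s"
    unfolding eq[symmetric] by (auto simp: inj_on_def)
  moreover have "?S \<noteq> {}"
    using A nth_mem[of 0 "take m necks"] m assms(2,3) by (fastforce simp: sub_def)
  moreover have "?S \<subseteq> strings k n"
  proof
    fix s
    assume "s \<in> ?S"
    then obtain w where w: "w \<in> set (take m necks)" "s \<in> sub n w" by auto
    then have "s \<in> (\<lambda>i. rotate i w) ` {..<n}" using A[of w] sub_eq_rotations[of w] by simp
    then show "s \<in> strings k n" using A[OF w(1)] by (auto simp: strings_def)
  qed
  moreover have "set ?U \<subseteq> {..<k}"
  proof -
    have "set (pr w) \<subseteq> set w" for w by (simp add: pr_def set_take_subset)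
    then show ?thesis using A by (fastforce simp: UC_def)
  qed
  ultimately show ?thesis
    unfolding universal_cycle_def using length_UC[of m] by blast
qed

end
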